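(* Let $(A,\cdot,\alpha)$ be a Hom-associative algebra acting on a Hom-associative algebra $(V,\cdot_V,\beta)$ via $(V,l,r,\beta,\cdot_V)$, and let $\mathcal H:V\to A$ be a homomorphic relative averaging operator. Then $\mathcal H$ is a homomorphic relative averaging operator on the associated Hom-Jordan algebra $(A,\circ,\alpha)$, $x\circ y=x\cdot y+y\cdot x$, with respect to the action $(V,\pi=l+r,\beta,\ast)$, where $u\ast v=u\cdot_V v+v\cdot_V u$. Moreover, let $(V,\vdash,\dashv,\bot,\beta)$ be the Hom-associative trialgebra given by $u\vdash v=l(\mathcal H(u))v$, $u\dashv v=r(\mathcal H(v))u$, $u\,\bot\,v=u\cdot_V v$; then $(V,\ast,\bullet,\beta)$ is a Hom-Jordan trialgebra, where $\bullet$ is the anti-dicommutator $u\bullet v=u\vdash v+v\dashv u$ (here $\ast$ is the Hom-Jordan algebra product and $\bullet$ the Hom-Jordan dialgebra product).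
   Context: All vector spaces are over a field $\mathbb K$ of characteristic $0$. All Hom-algebras are multiplicative, i.e. the twisting map preserves every bilinear operation of the structure. A Hom-associative algebra $(A,\cdot,\alpha)$ is a vector space $A$ with a bilinear operation $\cdot$ and a linear map $\alpha$ such that $(x\cdot y)\cdot\alpha(z)=\alpha(x)\cdot(y\cdot z)$. A bimodule $(V,l,r,\beta)$ of $(A,\cdot,\alpha)$ is a vector space $V$ with a linear map $\beta:V\to V$ and linear maps $l,r:A\to \mathrm{End}(V)$ such that for all $x,y\in A$: $\beta l(x)=l(\alpha(x))\beta$, $\beta r(x)=r(\alpha(x))\beta$, $l(x\cdot y)\beta=l(\alpha(x))l(y)$, $r(x\cdot y)\beta=r(\alpha(y))r(x)$, $l(\alpha(x))r(y)=r(\alpha(y))l(x)$. $(A,\cdot,\alpha)$ acts on a Hom-associative algebra $(V,\cdot_V,\beta)$ via $(V,l,r,\beta,\cdot_V)$ if $(V,l,r,\beta)$ is a bimodule of $A$ and for all $x\in A$, $u,v\in V$: $l(\alpha(x))(u\cdot_V v)=(l(x)u)\cdot_V\beta(v)$, $r(\alpha(x))(u\cdot_V v)=\beta(u)\cdot_V(r(x)v)$, $\beta(u)\cdot_V(l(x)v)=(r(x)u)\cdot_V\beta(v)$. A linear map $\mathcal H:V\to A$ is a homomorphic relative averaging operator (Hom-associative case) if $\mathcal H\beta=\alpha\mathcal H$ and $\mathcal H(u)\cdot\mathcal H(v)=\mathcal H(l(\mathcal H(u))v)=\mathcal H(r(\mathcal H(v))u)=\mathcal H(u\cdot_V v)$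 for all $u,v\in V$. A Hom-associative trialgebra $(D,\vdash,\dashv,\bot,\alpha)$ is a vector space with three bilinear operations and a linear map $\alpha$ such that $(D,\bot,\alpha)$ is a Hom-associative algebra and for all $x,y,z$: $(x\dashv y)\vdash\alpha(z)=(x\vdash y)\vdash\alpha(z)$; $\alpha(x)\dashv(y\dashv z)=\alpha(x)\dashv(y\vdash z)$; $(x\dashv y)\dashv\alpha(z)=\alpha(x)\dashv(y\dashv z)$; $(x\vdash y)\vdash\alpha(z)=\alpha(x)\vdash(y\vdash z)$; $(x\vdash y)\dashv\alpha(z)=\alpha(x)\vdash(y\dashv z)$; $(x\dashv y)\dashv\alpha(z)=\alpha(x)\dashv(y\,\bot\,z)$; $(x\,\bot\,y)\dashv\alpha(z)=\alpha(x)\,\bot\,(y\dashv z)$; $(x\dashv y)\,\bot\,\alpha(z)=\alpha(x)\,\bot\,(y\vdash z)$; $(x\vdash y)\,\bot\,\alpha(z)=\alpha(x)\vdash(y\,\bot\,z)$; $(x\,\bot\,y)\vdash\alpha(z)=\alpha(x)\vdash(y\vdash z)$. A Hom-Jordan algebra $(A,\circ,\alpha)$ is a vector space with a bilinear operation $\circ$ and a linear map $\alpha$ such that $x\circ y=y\circ x$ and $\alpha(x^2)\circ(\alpha(y)\circ\alpha(x))=(x^2\circ\alpha(y))\circ\alpha^2(x)$, where $x^2=x\circ x$. A module (representation) $(V,\pi,\beta)$ of a Hom-Jordan algebra $(A,\circ,\alpha)$ is a vector space $V$ with a linear map $\beta:V\to V$ and a linear map $\pi:A\to \mathrm{End}(V)$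 such that for all $x,y,z\in A$: $\beta\pi(x)=\pi(\alpha(x))\beta$; $\pi(\alpha^2(x))\pi(y\circ z)\beta+\pi(\alpha^2(y))\pi(z\circ x)\beta+\pi(\alpha^2(z))\pi(x\circ y)\beta=\pi(\alpha(x)\circ\alpha(y))\pi(\alpha(z))\beta+\pi(\alpha(y)\circ\alpha(z))\pi(\alpha(x))\beta+\pi(\alpha(z)\circ\alpha(x))\pi(\alpha(y))\beta$; $\pi((x\circ y)\circ\alpha(z))\beta^2+\pi(\alpha^2(x))\pi(\alpha(z))\pi(y)+\pi(\alpha^2(y))\pi(\alpha(z))\pi(x)=\pi(\alpha(x)\circ\alpha(y))\pi(\alpha(z))\beta+\pi(\alpha(y)\circ\alpha(z))\pi(\alpha(x))\beta+\pi(\alpha(x)\circ\alpha(z))\pi(\alpha(y))\beta$. An action $(V,\pi,\beta,\ast)$ of a Hom-Jordan algebra $(A,\circ,\alpha)$ on a Hom-Jordan algebra $(V,\ast,\beta)$ is a representation $(V,\pi,\beta)$ of $A$ such that for all $x,y\in A$, $u,v,w\in V$: (A1) $(\pi(\alpha(x))\beta(v))\ast(\beta(v)\ast\beta(v))=(\pi(\alpha(x))(v\ast v))\ast\beta^2(v)$; (A2) $(\pi(x)u\ast\beta(w))\ast\beta^2(v)+(\pi(x)v\ast\beta(w))\ast\beta^2(u)+\pi(\alpha^2(x))((u\ast v)\ast\beta(w))=(\pi(\alpha(x))(u\ast v))\ast\beta^2(w)+(\pi(\alpha(x))(u\ast w))\ast\beta^2(v)+(\pi(\alpha(x))(v\ast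 w))\ast\beta^2(u)$; (A3) $(\pi(\alpha(y))\pi(x)u)\ast\beta^2(v)+(\pi(\alpha(y))\pi(x)v)\ast\beta^2(u)+\pi(\alpha^2(x))\pi(\alpha(y))(u\ast v)=(\pi(x\circ y)\beta(v))\ast\beta^2(u)+\pi(\alpha^2(x))(\pi(y)u\ast\beta(v))+\pi(\alpha^2(y))(\pi(x)u\ast\beta(v))$; (A4) $(\pi(\alpha(y))\beta(u))\ast(\pi(\alpha(x))\beta(v))+(\pi(\alpha(x))\beta(u))\ast(\pi(\alpha(y))\beta(v))+\pi(\alpha(x)\circ\alpha(y))(\beta(u)\ast\beta(v))=(\pi(x\circ y)\beta(v))\ast\beta^2(u)+\pi(\alpha^2(x))(\pi(y)u\ast\beta(v))+\pi(\alpha^2(y))(\pi(x)u\ast\beta(v))$. A linear map $\mathcal H:V\to A$ is a homomorphic relative averaging operator on the Hom-Jordan algebra $A$ with respect to the action $(V,\pi,\beta,\ast)$ if $\mathcal H\beta=\alpha\mathcal H$ and $\mathcal H(u)\circ\mathcal H(v)=\mathcal H(\pi(\mathcal H(u))v)=\mathcal H(u\ast v)$ for all $u,v\in V$. A (left) Hom-Jordan dialgebra $(D,\bullet,\alpha)$ is a vector space with a bilinear operation $\bullet$ and a linear map $\alpha$ such that for all $x_1,x_2,x_3,x_4\in D$: (a) $(x_1\bullet x_2)\bullet x_3=(x_2\bullet x_1)\bullet x_3$; (b) $((x_4\bullet x_3)\bullet\alpha(x_2))\bullet\alpha^2(x_1)+\alpha^2(x_4)\bullet(\alpha(x_2)\bullet(x_3\bullet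 x_1))+\alpha^2(x_3)\bullet(\alpha(x_2)\bullet(x_4\bullet x_1))=\alpha(x_4\bullet x_3)\bullet(\alpha(x_2)\bullet\alpha(x_1))+(\alpha(x_4)\bullet\alpha(x_2))\bullet\alpha(x_3\bullet x_1)+(\alpha(x_3)\bullet\alpha(x_2))\bullet\alpha(x_4\bullet x_1)$; (c) $\alpha^2(x_1)\bullet((x_4\bullet x_3)\bullet\alpha(x_2))+\alpha^2(x_4)\bullet((x_3\bullet x_1)\bullet\alpha(x_2))+\alpha^2(x_3)\bullet((x_4\bullet x_1)\bullet\alpha(x_2))=\alpha(x_4\bullet x_3)\bullet(\alpha(x_1)\bullet\alpha(x_2))+\alpha(x_1\bullet x_3)\bullet(\alpha(x_4)\bullet\alpha(x_2))+\alpha(x_4\bullet x_1)\bullet(\alpha(x_3)\bullet\alpha(x_2))$. A Hom-Jordan trialgebra $(D,\circ,\bullet,\alpha)$ consists of a Hom-Jordan algebra $(D,\circ,\alpha)$ and a Hom-Jordan dialgebra $(D,\bullet,\alpha)$ such that for all $x_1,\dots,x_4\in D$: (T0) $(\alpha(x_1)\circ\alpha(x_1))\circ(\alpha(x_2)\bullet\alpha(x_1))=(\alpha(x_2)\bullet(x_1\circ x_1))\circ\alpha^2(x_1)$; (T1) $((x_4\bullet x_1)\circ\alpha(x_3))\circ\alpha^2(x_2)+((x_4\bullet x_2)\circ\alpha(x_3))\circ\alpha^2(x_1)+\alpha^2(x_4)\bullet((x_1\circ x_2)\circ\alpha(x_3))=(\alpha(x_4)\bullet(x_1\circ x_2))\circ\alpha^2(x_3)+(\alpha(x_4)\bullet(x_1\circ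 x_3))\circ\alpha^2(x_2)+(\alpha(x_4)\bullet(x_2\circ x_3))\circ\alpha^2(x_1)$; (T2) $(\alpha(x_3)\bullet(x_4\bullet x_1))\circ\alpha^2(x_2)+(\alpha(x_3)\bullet(x_4\bullet x_2))\circ\alpha^2(x_1)+\alpha^2(x_4)\bullet(\alpha(x_3)\bullet(x_1\circ x_2))=((x_4\bullet x_3)\bullet\alpha(x_2))\circ\alpha^2(x_1)+\alpha^2(x_4)\bullet((x_3\bullet x_1)\circ\alpha(x_2))+\alpha^2(x_3)\bullet((x_4\bullet x_1)\circ\alpha(x_2))$; (T3) $(\alpha(x_3)\bullet\alpha(x_1))\circ(\alpha(x_4)\bullet\alpha(x_2))+(\alpha(x_4)\bullet\alpha(x_1))\circ(\alpha(x_3)\bullet\alpha(x_2))+(\alpha(x_4)\bullet\alpha(x_3))\bullet(\alpha(x_1)\circ\alpha(x_2))=((x_4\bullet x_3)\bullet\alpha(x_2))\circ\alpha^2(x_1)+\alpha^2(x_4)\bullet((x_3\bullet x_1)\circ\alpha(x_2))+\alpha^2(x_3)\bullet((x_4\bullet x_1)\circ\alpha(x_2))$. *)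

theory Defs
  imports Complex_Main
begin

text \<open>
  A vector space over a field of characteristic 0 is an arbitrary scalar multiplication
  \<open>'k::field_char_0 \<Rightarrow> 'a::ab_group_add \<Rightarrow> 'a\<close> satisfying the library locale \<open>vector_space\<close>.
  The operations \<open>\<alpha>\<^sup>2\<close>, \<open>\<beta>\<^sup>2\<close> are written as iterated applications.
\<close>

definition bilinear_map ::
  "('k::field \<Rightarrow> 'a::ab_group_add \<Rightarrow> 'a) \<Rightarrow> ('k \<Rightarrow> 'b::ab_group_add \<Rightarrow> 'b) \<Rightarrow>
   ('k \<Rightarrow> 'c::ab_group_add \<Rightarrow> 'c) \<Rightarrow> ('a \<Rightarrow> 'b \<Rightarrow> 'c) \<Rightarrow> bool"
  where "bilinear_map sA sB sC f \<longleftrightarrow>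
    (\<forall>x. Vector_Spaces.linear sB sC (f x)) \<and> (\<forall>y. Vector_Spaces.linear sA sC (\<lambda>x. f x y))"

text \<open>
  A linear map \<open>A \<rightarrow> End(V)\<close> is a curried function \<open>'a \<Rightarrow> 'v \<Rightarrow> 'v\<close> satisfying
  \<open>bilinear_map sA sV sV\<close>: each value is an endomorphism of \<open>V\<close>, and the dependence on the
  first argument is linear for the pointwise structure of \<open>End(V)\<close>.
\<close>

text \<open>All Hom-algebras are multiplicative: the twisting map preserves the bilinear operation.\<close>

locale hom_algebra = vector_space sA
  for sA :: "'k::field_char_0 \<Rightarrow> 'a::ab_group_add \<Rightarrow> 'a" +
  fixes mult :: "'a \<Rightarrow> 'a \<Rightarrow> 'a" (infixl "\<cdot>" 70)
    and \<alpha> :: "'a \<Rightarrow> 'a"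
  assumes mult_bilinear: "bilinear_map sA sA sA (\<cdot>)"
    and twist_linear: "Vector_Spaces.linear sA sA \<alpha>"
    and multiplicative: "\<alpha> (x \<cdot> y) = \<alpha> x \<cdot> \<alpha> y"

locale hom_associative_algebra = hom_algebra sA mult \<alpha>
  for sA :: "'k::field_char_0 \<Rightarrow> 'a::ab_group_add \<Rightarrow> 'a"
    and mult (infixl "\<cdot>" 70) and \<alpha> +
  assumes hom_assoc: "(x \<cdot> y) \<cdot> \<alpha> z = \<alpha> x \<cdot> (y \<cdot> z)"

locale hom_associative_bimodule =
  A: hom_associative_algebra sA mult \<alpha> + V: vector_space sV
  for sA :: "'k::field_char_0 \<Rightarrow> 'a::ab_group_add \<Rightarrow> 'a"
    and mult (infixl "\<cdot>" 70) and \<alpha>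
    and sV :: "'k \<Rightarrow> 'v::ab_group_add \<Rightarrow> 'v" +
  fixes l r :: "'a \<Rightarrow> 'v \<Rightarrow> 'v" and \<beta> :: "'v \<Rightarrow> 'v"
  assumes l_linear: "bilinear_map sA sV sV l"
    and r_linear: "bilinear_map sA sV sV r"
    and beta_linear: "Vector_Spaces.linear sV sV \<beta>"
    and beta_l: "\<beta> (l x v) = l (\<alpha> x) (\<beta> v)"
    and beta_r: "\<beta> (r x v) = r (\<alpha> x) (\<beta> v)"
    and l_mult: "l (x \<cdot> y) (\<beta> v) = l (\<alpha> x) (l y v)"
    and r_mult: "r (x \<cdot> y) (\<beta> v) = r (\<alpha> y) (r x v)"
    and l_r: "l (\<alpha> x) (r y v) = r (\<alpha> y) (l x v)"

locale hom_associative_action =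
  hom_associative_bimodule sA mult \<alpha> sV l r \<beta> + VA: hom_associative_algebra sV multV \<beta>
  for sA :: "'k::field_char_0 \<Rightarrow> 'a::ab_group_add \<Rightarrow> 'a"
    and mult (infixl "\<cdot>" 70) and \<alpha>
    and sV :: "'k \<Rightarrow> 'v::ab_group_add \<Rightarrow> 'v"
    and l r \<beta> and multV (infixl "\<cdot>\<^sub>V" 70) +
  assumes l_multV: "l (\<alpha> x) (u \<cdot>\<^sub>V v) = l x u \<cdot>\<^sub>V \<beta> v"
    and r_multV: "r (\<alpha> x) (u \<cdot>\<^sub>V v) = \<beta> u \<cdot>\<^sub>V r x v"
    and l_r_multV: "\<beta> u \<cdot>\<^sub>V l x v = r x u \<cdot>\<^sub>V \<beta> v"

locale hom_associative_averaging_operator =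
  hom_associative_action sA mult \<alpha> sV l r \<beta> multV
  for sA :: "'k::field_char_0 \<Rightarrow> 'a::ab_group_add \<Rightarrow> 'a"
    and mult (infixl "\<cdot>" 70) and \<alpha>
    and sV :: "'k \<Rightarrow> 'v::ab_group_add \<Rightarrow> 'v"
    and l r \<beta> and multV (infixl "\<cdot>\<^sub>V" 70) +
  fixes H :: "'v \<Rightarrow> 'a"
  assumes H_linear: "Vector_Spaces.linear sV sA H"
    and H_beta: "H (\<beta> u) = \<alpha> (H u)"
    and H_l: "H u \<cdot> H v = H (l (H u) v)"
    and H_r: "H u \<cdot> H v = H (r (H v) u)"
    and H_hom: "H u \<cdot> H v = H (u \<cdot>\<^sub>V v)"

locale hom_associative_trialgebra =
  L: hom_algebra sD lprod \<alpha> + R: hom_algebra sD rprod \<alpha> +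
  B: hom_associative_algebra sD bprod \<alpha>
  for sD :: "'k::field_char_0 \<Rightarrow> 'd::ab_group_add \<Rightarrow> 'd"
    and lprod (infixl "\<turnstile>" 70) and rprod (infixl "\<stileturn>" 70)
    and bprod (infixl "\<bottom>" 70) and \<alpha> +
  assumes ax1: "(x \<stileturn> y) \<turnstile> \<alpha> z = (x \<turnstile> y) \<turnstile> \<alpha> z"
    and ax2: "\<alpha> x \<stileturn> (y \<stileturn> z) = \<alpha> x \<stileturn> (y \<turnstile> z)"
    and ax3: "(x \<stileturn> y) \<stileturn> \<alpha> z = \<alpha> x \<stileturn> (y \<stileturn> z)"
    and ax4: "(x \<turnstile> y) \<turnstile> \<alpha> z = \<alpha> x \<turnstile> (y \<turnstile> z)"
    and ax5: "(x \<turnstile> y) \<stileturn> \<alpha> z = \<alpha> x \<turnstile> (y \<stileturn> z)"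
    and ax6: "(x \<stileturn> y) \<stileturn> \<alpha> z = \<alpha> x \<stileturn> (y \<bottom> z)"
    and ax7: "(x \<bottom> y) \<stileturn> \<alpha> z = \<alpha> x \<bottom> (y \<stileturn> z)"
    and ax8: "(x \<stileturn> y) \<bottom> \<alpha> z = \<alpha> x \<bottom> (y \<turnstile> z)"
    and ax9: "(x \<turnstile> y) \<bottom> \<alpha> z = \<alpha> x \<turnstile> (y \<bottom> z)"
    and ax10: "(x \<bottom> y) \<turnstile> \<alpha> z = \<alpha> x \<turnstile> (y \<turnstile> z)"

locale hom_jordan_algebra = hom_algebra sA jmult \<alpha>
  for sA :: "'k::field_char_0 \<Rightarrow> 'a::ab_group_add \<Rightarrow> 'a"
    and jmult (infixl "\<odot>" 70) and \<alpha> +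
  assumes commute: "x \<odot> y = y \<odot> x"
    and hom_jordan: "\<alpha> (x \<odot> x) \<odot> (\<alpha> y \<odot> \<alpha> x) = ((x \<odot> x) \<odot> \<alpha> y) \<odot> \<alpha> (\<alpha> x)"

locale hom_jordan_module =
  A: hom_jordan_algebra sA jmult \<alpha> + V: vector_space sV
  for sA :: "'k::field_char_0 \<Rightarrow> 'a::ab_group_add \<Rightarrow> 'a"
    and jmult (infixl "\<odot>" 70) and \<alpha>
    and sV :: "'k \<Rightarrow> 'v::ab_group_add \<Rightarrow> 'v" +
  fixes \<pi> :: "'a \<Rightarrow> 'v \<Rightarrow> 'v" and \<beta> :: "'v \<Rightarrow> 'v"
  assumes pi_linear: "bilinear_map sA sV sV \<pi>"
    and beta_linear: "Vector_Spaces.linear sV sV \<beta>"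
    and beta_pi: "\<beta> (\<pi> x v) = \<pi> (\<alpha> x) (\<beta> v)"
    and module1:
      "\<pi> (\<alpha> (\<alpha> x)) (\<pi> (y \<odot> z) (\<beta> v)) + \<pi> (\<alpha> (\<alpha> y)) (\<pi> (z \<odot> x) (\<beta> v))
         + \<pi> (\<alpha> (\<alpha> z)) (\<pi> (x \<odot> y) (\<beta> v))
       = \<pi> (\<alpha> x \<odot> \<alpha> y) (\<pi> (\<alpha> z) (\<beta> v)) + \<pi> (\<alpha> y \<odot> \<alpha> z) (\<pi> (\<alpha> x) (\<beta> v))
         + \<pi> (\<alpha> z \<odot> \<alpha> x) (\<pi> (\<alpha> y) (\<beta> v))"
    and module2:
      "\<pi> ((x \<odot> y) \<odot> \<alpha> z) (\<beta> (\<beta> v)) + \<pi> (\<alpha> (\<alpha> x)) (\<pi> (\<alpha> z) (\<pi> y v))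
         + \<pi> (\<alpha> (\<alpha> y)) (\<pi> (\<alpha> z) (\<pi> x v))
       = \<pi> (\<alpha> x \<odot> \<alpha> y) (\<pi> (\<alpha> z) (\<beta> v)) + \<pi> (\<alpha> y \<odot> \<alpha> z) (\<pi> (\<alpha> x) (\<beta> v))
         + \<pi> (\<alpha> x \<odot> \<alpha> z) (\<pi> (\<alpha> y) (\<beta> v))"

locale hom_jordan_action =
  hom_jordan_module sA jmult \<alpha> sV \<pi> \<beta> + VA: hom_jordan_algebra sV jmultV \<beta>
  for sA :: "'k::field_char_0 \<Rightarrow> 'a::ab_group_add \<Rightarrow> 'a"
    and jmult (infixl "\<odot>" 70) and \<alpha>
    and sV :: "'k \<Rightarrow> 'v::ab_group_add \<Rightarrow> 'v"
    and \<pi> \<beta> and jmultV (infixl "\<star>" 70) +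
  assumes A1: "\<pi> (\<alpha> x) (\<beta> v) \<star> (\<beta> v \<star> \<beta> v) = \<pi> (\<alpha> x) (v \<star> v) \<star> \<beta> (\<beta> v)"
    and A2:
      "(\<pi> x u \<star> \<beta> w) \<star> \<beta> (\<beta> v) + (\<pi> x v \<star> \<beta> w) \<star> \<beta> (\<beta> u)
         + \<pi> (\<alpha> (\<alpha> x)) ((u \<star> v) \<star> \<beta> w)
       = \<pi> (\<alpha> x) (u \<star> v) \<star> \<beta> (\<beta> w) + \<pi> (\<alpha> x) (u \<star> w) \<star> \<beta> (\<beta> v)
         + \<pi> (\<alpha> x) (v \<star> w) \<star> \<beta> (\<beta> u)"
    and A3:
      "\<pi> (\<alpha> y) (\<pi> x u) \<star> \<beta> (\<beta> v) + \<pi> (\<alpha> y) (\<pi> x v) \<star> \<beta> (\<beta> u)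
         + \<pi> (\<alpha> (\<alpha> x)) (\<pi> (\<alpha> y) (u \<star> v))
       = \<pi> (x \<odot> y) (\<beta> v) \<star> \<beta> (\<beta> u) + \<pi> (\<alpha> (\<alpha> x)) (\<pi> y u \<star> \<beta> v)
         + \<pi> (\<alpha> (\<alpha> y)) (\<pi> x u \<star> \<beta> v)"
    and A4:
      "\<pi> (\<alpha> y) (\<beta> u) \<star> \<pi> (\<alpha> x) (\<beta> v) + \<pi> (\<alpha> x) (\<beta> u) \<star> \<pi> (\<alpha> y) (\<beta> v)
         + \<pi> (\<alpha> x \<odot> \<alpha> y) (\<beta> u \<star> \<beta> v)
       = \<pi> (x \<odot> y) (\<beta> v) \<star> \<beta> (\<beta> u) + \<pi> (\<alpha> (\<alpha> x)) (\<pi> y u \<star> \<beta> v)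
         + \<pi> (\<alpha> (\<alpha> y)) (\<pi> x u \<star> \<beta> v)"

locale hom_jordan_averaging_operator =
  hom_jordan_action sA jmult \<alpha> sV \<pi> \<beta> jmultV
  for sA :: "'k::field_char_0 \<Rightarrow> 'a::ab_group_add \<Rightarrow> 'a"
    and jmult (infixl "\<odot>" 70) and \<alpha>
    and sV :: "'k \<Rightarrow> 'v::ab_group_add \<Rightarrow> 'v"
    and \<pi> \<beta> and jmultV (infixl "\<star>" 70) +
  fixes H :: "'v \<Rightarrow> 'a"
  assumes H_linear: "Vector_Spaces.linear sV sA H"
    and H_beta: "H (\<beta> u) = \<alpha> (H u)"
    and H_pi: "H u \<odot> H v = H (\<pi> (H u) v)"
    and H_hom: "H u \<odot> H v = H (u \<star> v)"

locale hom_jordan_dialgebra = hom_algebra sD dmult \<alpha>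
  for sD :: "'k::field_char_0 \<Rightarrow> 'd::ab_group_add \<Rightarrow> 'd"
    and dmult (infixl "\<bullet>" 70) and \<alpha> +
  assumes dia: "(x1 \<bullet> x2) \<bullet> x3 = (x2 \<bullet> x1) \<bullet> x3"
    and dib:
      "((x4 \<bullet> x3) \<bullet> \<alpha> x2) \<bullet> \<alpha> (\<alpha> x1) + \<alpha> (\<alpha> x4) \<bullet> (\<alpha> x2 \<bullet> (x3 \<bullet> x1))
         + \<alpha> (\<alpha> x3) \<bullet> (\<alpha> x2 \<bullet> (x4 \<bullet> x1))
       = \<alpha> (x4 \<bullet> x3) \<bullet> (\<alpha> x2 \<bullet> \<alpha> x1) + (\<alpha> x4 \<bullet> \<alpha> x2) \<bullet> \<alpha> (x3 \<bullet> x1)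
         + (\<alpha> x3 \<bullet> \<alpha> x2) \<bullet> \<alpha> (x4 \<bullet> x1)"
    and dic:
      "\<alpha> (\<alpha> x1) \<bullet> ((x4 \<bullet> x3) \<bullet> \<alpha> x2) + \<alpha> (\<alpha> x4) \<bullet> ((x3 \<bullet> x1) \<bullet> \<alpha> x2)
         + \<alpha> (\<alpha> x3) \<bullet> ((x4 \<bullet> x1) \<bullet> \<alpha> x2)
       = \<alpha> (x4 \<bullet> x3) \<bullet> (\<alpha> x1 \<bullet> \<alpha> x2) + \<alpha> (x1 \<bullet> x3) \<bullet> (\<alpha> x4 \<bullet> \<alpha> x2)
         + \<alpha> (x4 \<bullet> x1) \<bullet> (\<alpha> x3 \<bullet> \<alpha> x2)"

locale hom_jordan_trialgebra =
  J: hom_jordan_algebra sD jmult \<alpha> + D: hom_jordan_dialgebra sD dmult \<alpha>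
  for sD :: "'k::field_char_0 \<Rightarrow> 'd::ab_group_add \<Rightarrow> 'd"
    and jmult (infixl "\<odot>" 70) and dmult (infixl "\<bullet>" 70) and \<alpha> +
  assumes T0: "(\<alpha> x1 \<odot> \<alpha> x1) \<odot> (\<alpha> x2 \<bullet> \<alpha> x1) = (\<alpha> x2 \<bullet> (x1 \<odot> x1)) \<odot> \<alpha> (\<alpha> x1)"
    and T1:
      "((x4 \<bullet> x1) \<odot> \<alpha> x3) \<odot> \<alpha> (\<alpha> x2) + ((x4 \<bullet> x2) \<odot> \<alpha> x3) \<odot> \<alpha> (\<alpha> x1)
         + \<alpha> (\<alpha> x4) \<bullet> ((x1 \<odot> x2) \<odot> \<alpha> x3)
       = (\<alpha> x4 \<bullet> (x1 \<odot> x2)) \<odot> \<alpha> (\<alpha> x3) + (\<alpha> x4 \<bullet> (x1 \<odot> x3)) \<odot> \<alpha> (\<alpha> x2)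
         + (\<alpha> x4 \<bullet> (x2 \<odot> x3)) \<odot> \<alpha> (\<alpha> x1)"
    and T2:
      "(\<alpha> x3 \<bullet> (x4 \<bullet> x1)) \<odot> \<alpha> (\<alpha> x2) + (\<alpha> x3 \<bullet> (x4 \<bullet> x2)) \<odot> \<alpha> (\<alpha> x1)
         + \<alpha> (\<alpha> x4) \<bullet> (\<alpha> x3 \<bullet> (x1 \<odot> x2))
       = ((x4 \<bullet> x3) \<bullet> \<alpha> x2) \<odot> \<alpha> (\<alpha> x1) + \<alpha> (\<alpha> x4) \<bullet> ((x3 \<bullet> x1) \<odot> \<alpha> x2)
         + \<alpha> (\<alpha> x3) \<bullet> ((x4 \<bullet> x1) \<odot> \<alpha> x2)"
    and T3:
      "(\<alpha> x3 \<bullet> \<alpha> x1) \<odot> (\<alpha> x4 \<bullet> \<alpha> x2) + (\<alpha> x4 \<bullet> \<alpha> x1) \<odot> (\<alpha> x3 \<bullet> \<alpha> x2)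
         + (\<alpha> x4 \<bullet> \<alpha> x3) \<bullet> (\<alpha> x1 \<odot> \<alpha> x2)
       = ((x4 \<bullet> x3) \<bullet> \<alpha> x2) \<odot> \<alpha> (\<alpha> x1) + \<alpha> (\<alpha> x4) \<bullet> ((x3 \<bullet> x1) \<odot> \<alpha> x2)
         + \<alpha> (\<alpha> x3) \<bullet> ((x4 \<bullet> x1) \<odot> \<alpha> x2)"

definition anticommutator :: "('a \<Rightarrow> 'a \<Rightarrow> 'a) \<Rightarrow> 'a \<Rightarrow> 'a \<Rightarrow> 'a::ab_group_add"
  where "anticommutator m x y = m x y + m y x"

definition anti_dicommutator ::
  "('a \<Rightarrow> 'a \<Rightarrow> 'a) \<Rightarrow> ('a \<Rightarrow> 'a \<Rightarrow> 'a) \<Rightarrow> 'a \<Rightarrow> 'a \<Rightarrow> 'a::ab_group_add"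
  where "anti_dicommutator lprod rprod u v = lprod u v + rprod v u"

end

theory Submission
  imports Defs "HOL-Library.Product_Plus"
begin

text \<open>
  A Hom-associative algebra \<open>A\<close> acting on another one \<open>V\<close> is the same thing as a Hom-associative
  structure on the semidirect product \<open>A \<times> V\<close>, twisted by \<open>\<alpha> \<times> \<beta>\<close>, in which \<open>V\<close> is an ideal and
  \<open>A\<close> a subalgebra: the bimodule and action axioms are the components of Hom-associativity and of
  multiplicativity of the twist on \<open>A \<times> V\<close>. So it is enough to understand identities in a single
  Hom-associative algebra.

  In such an algebra, all bracketings of a product of four factors with twists at the right places
  are equal (\<open>word4\<close>). Hence identities of degree four for the anticommutator can be
  checked by counting words, as in an associative algebra. This gives the Hom-Jordan identity and
  its polarised form (\<open>polarised_hom_jordan_identity\<close>); each side of the latter is the sum of the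
  24 words containing four given letters once each. The Hom-Jordan module identities and the
  conditions (A1)-(A4) follow from these two identities in \<open>A \<times> V\<close>, evaluated on elements of \<open>A\<close>
  and of \<open>V\<close> (\<open>hom_jordan_action_anticommutator\<close>).

  The remaining claims are substitutions. For an averaging operator \<open>H\<close>, every product
  of the trialgebra is the action of an element \<open>H u\<close> or the product of \<open>V\<close>, and \<open>H\<close> sends all
  three products on \<open>V\<close> to the product of \<open>A\<close>. So the axioms of a Hom-associative trialgebra are
  bimodule and action axioms at elements \<open>H u\<close>, and the axioms of a Hom-Jordan trialgebra likewise
  come from those of a Hom-Jordan action, for any averaging operator on a Hom-Jordan algebra
  (\<open>hom_jordan_trialgebra_of_averaging_operator\<close>).
\<close>

section \<open>Linearity\<close>

lemma bilinear_mapI: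
  assumes "vector_space sA" "vector_space sB" "vector_space sC"
    and "\<And>x y z. f (x + y) z = f x z + f y z"
    and "\<And>x y z. f x (y + z) = f x y + f x z"
    and "\<And>c x y. f (sA c x) y = sC c (f x y)"
    and "\<And>c x y. f x (sB c y) = sC c (f x y)"
  shows "bilinear_map sA sB sC f"
  using assms by (simp add: bilinear_map_def Vector_Spaces.linear_iff)

lemma bilinear_map_simps:
  assumes "bilinear_map sA sB sC f"
  shows "f (x + y) z = f x z + f y z" "f x (z + w) = f x z + f x w"
    and "f (sA c x) z = sC c (f x z)" "f x (sB c z) = sC c (f x z)"
    and "f 0 z = 0" "f x 0 = 0"
proof -
  have l: "module_hom sA sC (\<lambda>x. f x z)" "module_hom sB sC (f x)" for x z
    using assms by (simp_all add: bilinear_map_def module_hom_iff_linear)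
  show "f (x + y) z = f x z + f y z" "f (sA c x) z = sC c (f x z)" "f 0 z = 0"
    using module_hom.add[OF l(1)] module_hom.scale[OF l(1)] module_hom.zero[OF l(1)] by auto
  show "f x (z + w) = f x z + f x w" "f x (sB c z) = sC c (f x z)" "f x 0 = 0"
    using module_hom.add[OF l(2)] module_hom.scale[OF l(2)] module_hom.zero[OF l(2)] by auto
qed

lemma linear_simps:
  assumes "Vector_Spaces.linear sA sB f"
  shows "f (x + y) = f x + f y" "f (sA c x) = sB c (f x)" "f 0 = 0"
proof -
  have l: "module_hom sA sB f"
    using assms by (simp add: module_hom_iff_linear)
  show "f (x + y) = f x + f y" "f (sA c x) = sB c (f x)" "f 0 = 0"
    using module_hom.add[OF l] module_hom.scale[OF l] module_hom.zero[OF l] by auto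
qed

lemma (in vector_space) bilinear_map_anticommutator:
  assumes "bilinear_map scale scale scale m"
  shows "bilinear_map scale scale scale (anticommutator m)"
  by (rule bilinear_mapI)
    (simp_all add: anticommutator_def bilinear_map_simps[OF assms] scale_right_distrib
      vector_space_axioms add_ac)

section \<open>The Hom-Jordan algebra of a Hom-associative algebra\<close>

context hom_associative_algebra
begin

lemmas ring_simps = bilinear_map_simps[OF mult_bilinear] linear_simps[OF twist_linear]

text \<open>
  The twists record the bracketing in such a way that Hom-associativity moves every bracketing of a
  word of length four to the right-nested one; multiplicativity is needed for the balanced
  bracketing, where \<open>\<alpha> z \<cdot> \<alpha> w\<close> must be read as \<open>\<alpha> (z \<cdot> w)\<close>.
\<close>

lemma word4:
  "((x \<cdot> y) \<cdot> \<alpha> z) \<cdot> \<alpha> (\<alpha> w) = \<alpha> (\<alpha> x) \<cdot> (\<alpha> y \<cdot> (z \<cdot> w))"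
  "(\<alpha> x \<cdot> (y \<cdot> z)) \<cdot> \<alpha> (\<alpha> w) = \<alpha> (\<alpha> x) \<cdot> (\<alpha> y \<cdot> (z \<cdot> w))"
  "\<alpha> (\<alpha> x) \<cdot> ((y \<cdot> z) \<cdot> \<alpha> w) = \<alpha> (\<alpha> x) \<cdot> (\<alpha> y \<cdot> (z \<cdot> w))"
  "(\<alpha> x \<cdot> \<alpha> y) \<cdot> (\<alpha> z \<cdot> \<alpha> w) = \<alpha> (\<alpha> x) \<cdot> (\<alpha> y \<cdot> (z \<cdot> w))"
proof -
  show a: "\<alpha> (\<alpha> x) \<cdot> ((y \<cdot> z) \<cdot> \<alpha> w) = \<alpha> (\<alpha> x) \<cdot> (\<alpha> y \<cdot> (z \<cdot> w))" for x y z w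
    by (simp add: hom_assoc)
  show b: "(\<alpha> x \<cdot> (y \<cdot> z)) \<cdot> \<alpha> (\<alpha> w) = \<alpha> (\<alpha> x) \<cdot> (\<alpha> y \<cdot> (z \<cdot> w))" for x y z w
    by (simp add: hom_assoc)
  show "((x \<cdot> y) \<cdot> \<alpha> z) \<cdot> \<alpha> (\<alpha> w) = \<alpha> (\<alpha> x) \<cdot> (\<alpha> y \<cdot> (z \<cdot> w))"
    by (simp add: hom_assoc[of x] b)
  show "(\<alpha> x \<cdot> \<alpha> y) \<cdot> (\<alpha> z \<cdot> \<alpha> w) = \<alpha> (\<alpha> x) \<cdot> (\<alpha> y \<cdot> (z \<cdot> w))"
    using hom_assoc[of "\<alpha> x" "\<alpha> y" "z \<cdot> w"] by (simp add: multiplicative)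
qed

abbreviation jordan_product (infixl "\<odot>" 70)
  where "x \<odot> y \<equiv> anticommutator (\<cdot>) x y"

lemma jordan_product_commute: "x \<odot> y = y \<odot> x"
  by (simp add: anticommutator_def add.commute)

lemma twist_jordan_product: "\<alpha> (x \<odot> y) = \<alpha> x \<odot> \<alpha> y"
  by (simp add: anticommutator_def ring_simps multiplicative)

text \<open>
  By \<open>word4\<close>, only the words matter. On the left, \<open>w\<close> occupies each of the four
  positions in one part of the expansion of \<open>x ((y z) w)\<close>, next to \<open>x\<close> and both orders of \<open>y\<close>, \<open>z\<close>;
  the cyclic sum then gives all orders of the other three letters. On the right the expansion of
  \<open>(x y) (z w)\<close> behaves in the same way. Both sides are therefore the sum of all 24 words, each
  occurring once. This symmetry is also why one identity, up to the order of its arguments, covers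
  the two module identities and (A2)-(A4) below.
\<close>

lemma polarised_hom_jordan_identity:
  "\<alpha> (\<alpha> x) \<odot> ((y \<odot> z) \<odot> \<alpha> w) + \<alpha> (\<alpha> y) \<odot> ((z \<odot> x) \<odot> \<alpha> w)
     + \<alpha> (\<alpha> z) \<odot> ((x \<odot> y) \<odot> \<alpha> w)
   = (\<alpha> x \<odot> \<alpha> y) \<odot> (\<alpha> z \<odot> \<alpha> w) + (\<alpha> y \<odot> \<alpha> z) \<odot> (\<alpha> x \<odot> \<alpha> w)
     + (\<alpha> z \<odot> \<alpha> x) \<odot> (\<alpha> y \<odot> \<alpha> w)"
  unfolding anticommutator_def
  by (simp only: ring_simps word4 add_ac)

lemma hom_jordan_algebra_anticommutator: "hom_jordan_algebra sA (\<odot>) \<alpha>"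
proof
  show "bilinear_map sA sA sA (\<odot>)"
    by (rule bilinear_map_anticommutator[OF mult_bilinear])
  \<comment> \<open>Both sides are twice the sum of the four words in which \<open>x\<close> occurs three times and \<open>y\<close> once.\<close>
  show "\<alpha> (x \<odot> x) \<odot> (\<alpha> y \<odot> \<alpha> x) = ((x \<odot> x) \<odot> \<alpha> y) \<odot> \<alpha> (\<alpha> x)" for x y
    unfolding anticommutator_def
    by (simp only: ring_simps multiplicative word4 add_ac)
qed (simp_all add: ring_simps twist_jordan_product jordan_product_commute)

end

section \<open>The semidirect product\<close>

context hom_associative_action
begin

definition semidirect_scale :: "'k \<Rightarrow> 'a \<times> 'v \<Rightarrow> 'a \<times> 'v"
  where "semidirect_scale c p = (sA c (fst p), sV c (snd p))"

definition semidirect_mult :: "'a \<times> 'v \<Rightarrow> 'a \<times> 'v \<Rightarrow> 'a \<times> 'v"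
  where "semidirect_mult p q =
    (fst p \<cdot> fst q, l (fst p) (snd q) + r (fst q) (snd p) + snd p \<cdot>\<^sub>V snd q)"

definition semidirect_twist :: "'a \<times> 'v \<Rightarrow> 'a \<times> 'v"
  where "semidirect_twist p = (\<alpha> (fst p), \<beta> (snd p))"

lemmas action_simps = A.ring_simps VA.ring_simps
  bilinear_map_simps[OF l_linear] bilinear_map_simps[OF r_linear]

lemma vector_space_semidirect: "vector_space semidirect_scale"
  by unfold_locales
    (simp_all add: semidirect_scale_def prod_eq_iff A.scale_right_distrib V.scale_right_distrib
      A.scale_left_distrib V.scale_left_distrib)

text \<open>
  The \<open>V\<close>-component of Hom-associativity on three pairs is a sum of seven identities, one for each
  choice of factors from \<open>A\<close> and \<open>V\<close> with at least one from \<open>V\<close>: the three bimodule axioms, the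
  three action axioms, and Hom-associativity of \<open>V\<close>.
\<close>

sublocale semidirect: hom_associative_algebra semidirect_scale semidirect_mult semidirect_twist
proof (intro hom_associative_algebra.intro hom_algebra.intro hom_algebra_axioms.intro
    hom_associative_algebra_axioms.intro)
  show "vector_space semidirect_scale"
    by (rule vector_space_semidirect)
  show "bilinear_map semidirect_scale semidirect_scale semidirect_scale semidirect_mult"
    by (rule bilinear_mapI)
      (simp_all add: vector_space_semidirect semidirect_scale_def semidirect_mult_def action_simps
        V.scale_right_distrib add_ac)
  show "Vector_Spaces.linear semidirect_scale semidirect_scale semidirect_twist"
    by (simp add: Vector_Spaces.linear_iff vector_space_semidirect semidirect_scale_def
        semidirect_twist_def action_simps)
  show "semidirect_twist (semidirect_mult p q)
      = semidirect_mult (semidirect_twist p) (semidirect_twist q)" for p q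
    by (simp add: semidirect_mult_def semidirect_twist_def action_simps A.multiplicative
        VA.multiplicative beta_l beta_r)
  show "semidirect_mult (semidirect_mult p q) (semidirect_twist s)
      = semidirect_mult (semidirect_twist p) (semidirect_mult q s)" for p q s
    by (simp add: semidirect_mult_def semidirect_twist_def action_simps A.hom_assoc VA.hom_assoc
        l_mult r_mult l_r l_multV r_multV l_r_multV add_ac)
qed

abbreviation jordan_action ("\<pi>")
  where "\<pi> x v \<equiv> l x v + r x v"

lemma semidirect_jordan_product:
  "semidirect.jordan_product (x, 0) (y, 0) = (A.jordan_product x y, 0)"
  "semidirect.jordan_product (x, 0) (0, v) = (0, \<pi> x v)"
  "semidirect.jordan_product (0, u) (y, 0) = (0, \<pi> y u)"
  "semidirect.jordan_product (0, u) (0, v) = (0, VA.jordan_product u v)"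
  by (simp_all add: anticommutator_def semidirect_mult_def action_simps add_ac)

lemma semidirect_twist_embedding:
  "semidirect_twist (x, 0) = (\<alpha> x, 0)" "semidirect_twist (0, v) = (0, \<beta> v)"
  by (simp_all add: semidirect_twist_def action_simps)

lemmas embedding_simps = semidirect_jordan_product semidirect_twist_embedding

lemmas semidirect_identity = semidirect.polarised_hom_jordan_identity

lemma jordan_action_linear: "bilinear_map sA sV sV \<pi>"
  by (rule bilinear_mapI)
    (simp_all add: A.vector_space_axioms V.vector_space_axioms action_simps
      V.scale_right_distrib add_ac)

text \<open>
  In \<open>A \<times> V\<close>, condition (A1) is the Hom-Jordan identity for an element of \<open>V\<close> squared, and the
  other conditions come from the polarised identity, whose distinguished letter \<open>w\<close> may be taken from
  \<open>A\<close> or from \<open>V\<close>. In (A2) and (A3) both sides are left-hand sides of the polarised identity,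
  for the same four letters but different choices of \<open>w\<close>; they agree because the right-hand side is
  symmetric in all four letters.
\<close>

lemma hom_jordan_action_anticommutator:
  "hom_jordan_action sA A.jordan_product \<alpha> sV \<pi> \<beta> VA.jordan_product"
proof -
  interpret JA: hom_jordan_algebra sA A.jordan_product \<alpha>
    by (rule A.hom_jordan_algebra_anticommutator)
  interpret JV: hom_jordan_algebra sV VA.jordan_product \<beta>
    by (rule VA.hom_jordan_algebra_anticommutator)
  interpret JE: hom_jordan_algebra semidirect_scale semidirect.jordan_product semidirect_twist
    by (rule semidirect.hom_jordan_algebra_anticommutator)
  let ?J = "A.jordan_product" and ?V = "VA.jordan_product"
  note to_components = embedding_simps add_Pair prod.inject
  show ?thesis
  proof (intro hom_jordan_action.intro hom_jordan_module.intro hom_jordan_module_axioms.intro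
      hom_jordan_action_axioms.intro)
    fix x y z v
    show "\<pi> (\<alpha> (\<alpha> x)) (\<pi> (?J y z) (\<beta> v)) + \<pi> (\<alpha> (\<alpha> y)) (\<pi> (?J z x) (\<beta> v))
           + \<pi> (\<alpha> (\<alpha> z)) (\<pi> (?J x y) (\<beta> v))
         = \<pi> (?J (\<alpha> x) (\<alpha> y)) (\<pi> (\<alpha> z) (\<beta> v)) + \<pi> (?J (\<alpha> y) (\<alpha> z)) (\<pi> (\<alpha> x) (\<beta> v))
           + \<pi> (?J (\<alpha> z) (\<alpha> x)) (\<pi> (\<alpha> y) (\<beta> v))"
      using semidirect_identity[of "(x, 0)" "(y, 0)" "(z, 0)" "(0, v)"]
      by (simp only: to_components)
    \<comment> \<open>The second module identity is the first one with \<open>v\<close> and \<open>z\<close> exchanged inside \<open>A \<times> V\<close>.\<close>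
    show "\<pi> (?J (?J x y) (\<alpha> z)) (\<beta> (\<beta> v)) + \<pi> (\<alpha> (\<alpha> x)) (\<pi> (\<alpha> z) (\<pi> y v))
           + \<pi> (\<alpha> (\<alpha> y)) (\<pi> (\<alpha> z) (\<pi> x v))
         = \<pi> (?J (\<alpha> x) (\<alpha> y)) (\<pi> (\<alpha> z) (\<beta> v)) + \<pi> (?J (\<alpha> y) (\<alpha> z)) (\<pi> (\<alpha> x) (\<beta> v))
           + \<pi> (?J (\<alpha> x) (\<alpha> z)) (\<pi> (\<alpha> y) (\<beta> v))"
      using semidirect_identity[of "(x, 0)" "(y, 0)" "(0, v)" "(z, 0)"]
      by (simp only: to_components) (simp only: JA.commute add_ac)
  next
    fix x v
    show "?V (\<pi> (\<alpha> x) (\<beta> v)) (?V (\<beta> v) (\<beta> v)) = ?V (\<pi> (\<alpha> x) (?V v v)) (\<beta> (\<beta> v))"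
      using JE.hom_jordan[of "(0, v)" "(x, 0)"]
      by (simp only: to_components JV.multiplicative JV.commute)
  next
    fix x u w v
    note left = semidirect_identity[of "(0, v)" "(0, u)" "(x, 0)" "(0, w)", simplified to_components]
    note right = semidirect_identity[of "(0, u)" "(0, v)" "(0, w)" "(x, 0)", simplified to_components]
    show "?V (?V (\<pi> x u) (\<beta> w)) (\<beta> (\<beta> v)) + ?V (?V (\<pi> x v) (\<beta> w)) (\<beta> (\<beta> u))
           + \<pi> (\<alpha> (\<alpha> x)) (?V (?V u v) (\<beta> w))
         = ?V (\<pi> (\<alpha> x) (?V u v)) (\<beta> (\<beta> w)) + ?V (\<pi> (\<alpha> x) (?V u w)) (\<beta> (\<beta> v))
           + ?V (\<pi> (\<alpha> x) (?V v w)) (\<beta> (\<beta> u))"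
      using left right by (simp only: JV.commute add_ac)
  next
    fix x y u v
    note left = semidirect_identity[of "(0, v)" "(0, u)" "(x, 0)" "(y, 0)", simplified to_components]
    note right = semidirect_identity[of "(x, 0)" "(y, 0)" "(0, u)" "(0, v)", simplified to_components]
    show "?V (\<pi> (\<alpha> y) (\<pi> x u)) (\<beta> (\<beta> v)) + ?V (\<pi> (\<alpha> y) (\<pi> x v)) (\<beta> (\<beta> u))
           + \<pi> (\<alpha> (\<alpha> x)) (\<pi> (\<alpha> y) (?V u v))
         = ?V (\<pi> (?J x y) (\<beta> v)) (\<beta> (\<beta> u)) + \<pi> (\<alpha> (\<alpha> x)) (?V (\<pi> y u) (\<beta> v))
           + \<pi> (\<alpha> (\<alpha> y)) (?V (\<pi> x u) (\<beta> v))"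
      using left right by (simp only: JV.commute JA.commute add_ac)
    show "?V (\<pi> (\<alpha> y) (\<beta> u)) (\<pi> (\<alpha> x) (\<beta> v)) + ?V (\<pi> (\<alpha> x) (\<beta> u)) (\<pi> (\<alpha> y) (\<beta> v))
           + \<pi> (?J (\<alpha> x) (\<alpha> y)) (?V (\<beta> u) (\<beta> v))
         = ?V (\<pi> (?J x y) (\<beta> v)) (\<beta> (\<beta> u)) + \<pi> (\<alpha> (\<alpha> x)) (?V (\<pi> y u) (\<beta> v))
           + \<pi> (\<alpha> (\<alpha> y)) (?V (\<pi> x u) (\<beta> v))"
      using right by (simp only: JV.commute JA.commute add_ac)
  qed (simp_all add: JA.hom_jordan_algebra_axioms JV.hom_jordan_algebra_axioms V.vector_space_axioms
      jordan_action_linear beta_linear beta_l beta_r action_simps)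
qed

end

section \<open>The trialgebras of an averaging operator\<close>

context hom_associative_averaging_operator
begin

lemma hom_jordan_averaging_operator_anticommutator:
  "hom_jordan_averaging_operator sA A.jordan_product \<alpha> sV \<pi> \<beta> VA.jordan_product H"
proof (intro hom_jordan_averaging_operator.intro hom_jordan_action_anticommutator
    hom_jordan_averaging_operator_axioms.intro H_linear H_beta)
  fix u v
  note H_add = linear_simps(1)[OF H_linear]
  show "A.jordan_product (H u) (H v) = H (\<pi> (H u) v)"
    by (simp add: anticommutator_def H_add H_l[symmetric] H_r[symmetric])
  show "A.jordan_product (H u) (H v) = H (VA.jordan_product u v)"
    by (simp add: anticommutator_def H_add H_hom[symmetric])
qed

text \<open>
  Since \<open>H\<close> does not distinguish the three products, a product under \<open>H\<close> becomes the product of \<open>A\<close>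
  whatever its kind. This settles \<open>ax1\<close> and \<open>ax2\<close>; the other axioms are then bimodule and action
  axioms at elements \<open>H u\<close>.
\<close>

lemma hom_associative_trialgebra_of_averaging_operator:
  "hom_associative_trialgebra sV (\<lambda>u v. l (H u) v) (\<lambda>u v. r (H v) u) (\<cdot>\<^sub>V) \<beta>"
proof -
  note H_simps = linear_simps[OF H_linear] H_beta H_l[symmetric] H_r[symmetric] H_hom[symmetric]
  have "hom_algebra sV (\<lambda>u v. l (H u) v) \<beta>"
    by (intro hom_algebra.intro hom_algebra_axioms.intro bilinear_mapI V.vector_space_axioms
        beta_linear) (simp_all add: H_simps action_simps beta_l)
  moreover have "hom_algebra sV (\<lambda>u v. r (H v) u) \<beta>"
    by (intro hom_algebra.intro hom_algebra_axioms.intro bilinear_mapI V.vector_space_axioms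
        beta_linear) (simp_all add: H_simps action_simps beta_r)
  ultimately show ?thesis
    by (intro hom_associative_trialgebra.intro hom_associative_trialgebra_axioms.intro
        VA.hom_associative_algebra_axioms)
      (simp_all add: H_simps l_mult r_mult l_r l_multV r_multV l_r_multV)
qed

end

text \<open>
  With \<open>u \<bullet> v = \<pi> (H u) v\<close>, left multiplication by \<open>u\<close> depends only on \<open>H u\<close>, and
  \<open>H (u \<bullet> v) = H u \<odot> H v\<close> is symmetric, which is the first dialgebra axiom. The other dialgebra axioms
  are the two module identities, and (T0)-(T3) are (A1)-(A4), at elements \<open>H u\<close>.
\<close>

lemma (in hom_jordan_averaging_operator) hom_jordan_trialgebra_of_averaging_operator:
  "hom_jordan_trialgebra sV (\<star>) (\<lambda>u v. \<pi> (H u) v) \<beta>"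
proof -
  \<comment> \<open>The image of \<open>H\<close> is closed under \<open>\<alpha>\<close> and \<open>\<odot>\<close>; for rewriting, the averaging identity is needed
    also at image elements that are written in this form.\<close>
  have H_pi_twist: "H (\<pi> (\<alpha> (H u)) v) = \<alpha> (H u) \<odot> H v" for u v
    using H_pi[of "\<beta> u" v] by (simp add: H_beta)
  have H_pi_mult: "H (\<pi> (H u \<odot> H v) w) = (H u \<odot> H v) \<odot> H w" for u v w
    using H_pi[of "u \<star> v" w] by (simp add: H_hom[symmetric])
  note H_simps = linear_simps[OF H_linear] H_beta H_pi[symmetric] H_hom[symmetric]
    H_pi_twist H_pi_mult
  have "hom_algebra sV (\<lambda>u v. \<pi> (H u) v) \<beta>"
    by (intro hom_algebra.intro hom_algebra_axioms.intro bilinear_mapI V.vector_space_axioms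
        beta_linear)
      (simp_all add: H_simps bilinear_map_simps[OF pi_linear] beta_pi)
  moreover have "hom_jordan_dialgebra_axioms (\<lambda>u v. \<pi> (H u) v) \<beta>"
  proof
    fix x1 x2 x3 x4
    show "\<pi> (H (\<pi> (H x1) x2)) x3 = \<pi> (H (\<pi> (H x2) x1)) x3"
      by (simp add: H_simps A.commute)
    show "\<pi> (H (\<pi> (H (\<pi> (H x4) x3)) (\<beta> x2))) (\<beta> (\<beta> x1))
           + \<pi> (H (\<beta> (\<beta> x4))) (\<pi> (H (\<beta> x2)) (\<pi> (H x3) x1))
           + \<pi> (H (\<beta> (\<beta> x3))) (\<pi> (H (\<beta> x2)) (\<pi> (H x4) x1))
         = \<pi> (H (\<beta> (\<pi> (H x4) x3))) (\<pi> (H (\<beta> x2)) (\<beta> x1))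
           + \<pi> (H (\<pi> (H (\<beta> x4)) (\<beta> x2))) (\<beta> (\<pi> (H x3) x1))
           + \<pi> (H (\<pi> (H (\<beta> x3)) (\<beta> x2))) (\<beta> (\<pi> (H x4) x1))"
      using module2[of "H x4" "H x3" "H x2" x1]
      by (simp only: H_simps beta_pi A.multiplicative add_ac)
    show "\<pi> (H (\<beta> (\<beta> x1))) (\<pi> (H (\<pi> (H x4) x3)) (\<beta> x2))
           + \<pi> (H (\<beta> (\<beta> x4))) (\<pi> (H (\<pi> (H x3) x1)) (\<beta> x2))
           + \<pi> (H (\<beta> (\<beta> x3))) (\<pi> (H (\<pi> (H x4) x1)) (\<beta> x2))
         = \<pi> (H (\<beta> (\<pi> (H x4) x3))) (\<pi> (H (\<beta> x1)) (\<beta> x2))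
           + \<pi> (H (\<beta> (\<pi> (H x1) x3))) (\<pi> (H (\<beta> x4)) (\<beta> x2))
           + \<pi> (H (\<beta> (\<pi> (H x4) x1))) (\<pi> (H (\<beta> x3)) (\<beta> x2))"
      using module1[of "H x1" "H x4" "H x3" x2]
      by (simp only: H_simps A.multiplicative A.commute add_ac)
  qed
  moreover have "hom_jordan_trialgebra_axioms (\<star>) (\<lambda>u v. \<pi> (H u) v) \<beta>"
  proof
    fix x1 x2 x3 x4
    show "(\<beta> x1 \<star> \<beta> x1) \<star> \<pi> (H (\<beta> x2)) (\<beta> x1) = \<pi> (H (\<beta> x2)) (x1 \<star> x1) \<star> \<beta> (\<beta> x1)"
      using A1[of "H x2" x1] by (simp only: H_simps VA.commute)
  qed (simp_all only: H_simps A2 A3 A4)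
  ultimately show ?thesis
    by (intro hom_jordan_trialgebra.intro hom_jordan_dialgebra.intro
        VA.hom_jordan_algebra_axioms)
qed

theorem theorem4p32:
  fixes sA :: "'k::field_char_0 \<Rightarrow> 'a::ab_group_add \<Rightarrow> 'a"
    and sV :: "'k \<Rightarrow> 'v::ab_group_add \<Rightarrow> 'v"
    and mult :: "'a \<Rightarrow> 'a \<Rightarrow> 'a" and \<alpha> :: "'a \<Rightarrow> 'a"
    and multV :: "'v \<Rightarrow> 'v \<Rightarrow> 'v" and \<beta> :: "'v \<Rightarrow> 'v"
    and l r :: "'a \<Rightarrow> 'v \<Rightarrow> 'v" and H :: "'v \<Rightarrow> 'a"
  assumes "hom_associative_action sA mult \<alpha> sV l r \<beta> multV"
    and "hom_associative_averaging_operator sA mult \<alpha> sV l r \<beta> multV H"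
  shows "hom_jordan_averaging_operator sA (anticommutator mult) \<alpha> sV
           (\<lambda>x v. l x v + r x v) \<beta> (anticommutator multV) H
    \<and> hom_associative_trialgebra sV (\<lambda>u v. l (H u) v) (\<lambda>u v. r (H v) u) multV \<beta>
    \<and> hom_jordan_trialgebra sV (anticommutator multV)
           (anti_dicommutator (\<lambda>u v. l (H u) v) (\<lambda>u v. r (H v) u)) \<beta>"
proof (intro conjI)
  interpret hom_associative_averaging_operator sA mult \<alpha> sV l r \<beta> multV H
    by (rule assms(2))
  show averaging: "hom_jordan_averaging_operator sA (anticommutator mult) \<alpha> sV
      (\<lambda>x v. l x v + r x v) \<beta> (anticommutator multV) H"
    by (rule hom_jordan_averaging_operator_anticommutator)
  show "hom_associative_trialgebra sV (\<lambda>u v. l (H u) v) (\<lambda>u v. r (H v) u) multV \<beta>"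
    by (rule hom_associative_trialgebra_of_averaging_operator)
  have "anti_dicommutator (\<lambda>u v. l (H u) v) (\<lambda>u v. r (H v) u) = (\<lambda>u v. l (H u) v + r (H u) v)"
    by (simp add: anti_dicommutator_def fun_eq_iff)
  then show "hom_jordan_trialgebra sV (anticommutator multV)
      (anti_dicommutator (\<lambda>u v. l (H u) v) (\<lambda>u v. r (H v) u)) \<beta>"
    using hom_jordan_averaging_operator.hom_jordan_trialgebra_of_averaging_operator[OF averaging]
    by simp
qed

end
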